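(* Let $(p_n)_{n\in\mathbb{N}}\subset\mathbb{R}$, with $p_n>2$ for every $n$, and $(f_n)_{n\in\mathbb{N}}\subset L^\infty(B_1)$ be sequences such that $$|p_n-2|+\|f_n\|_{L^\infty(B_1)}\le\frac1n\quad\text{for every } n\in\mathbb{N}.$$ Let $u_n\in W^{1,p_n}(B_1)$, $n\in\mathbb{N}$, be weak solutions to $$\operatorname{div}\left(|Du_n|^{p_n-2}Du_n\right)=f_n\quad\text{in } B_1.$$ Suppose further that there exists $u_\infty\in\mathcal{C}^1(B_1)$ such that $u_n$ converges to $u_\infty$ in $\mathcal{C}^1(B_1)$. Then $u_\infty$ is a weak solution to $$\Delta u_\infty=0\quad\text{in } B_{9/10}.$$
   Context: $B_r\subset\mathbb{R}^d$ denotes the open ball of radius $r$ centered at the origin. For $p>2$, a function $u\in W^{1,p}(B_1)$ is a weak solution to $\operatorname{div}(|Du|^{p-2}Du)=f$ in $B_1$ if $$\int_{B_1}|Du|^{p-2}Du\cdot D\varphi\,dx+\int_{B_1}f\varphi\,dx=0\quad\text{for every }\varphi\in\mathcal{C}_0^\infty(B_1).$$ A weak solution to $\Delta u_\infty=0$ in $B_{9/10}$ is a function with $\int_{B_{9/10}}Du_\infty\cdot D\varphi\,dx=0$ for every $\varphi\in\mathcal{C}_0^\infty(B_{9/10})$. *)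

theory Defs
  imports "HOL-Probability.Essential_Supremum"
begin

definition grad :: "('a::euclidean_space \<Rightarrow> real) \<Rightarrow> 'a \<Rightarrow> 'a" where
  "grad f x = (\<Sum>i\<in>Basis. frechet_derivative f (at x) i *\<^sub>R i)"

lemma grad_eqI:
  assumes "GDERIV f x :> D"
  shows "grad f x = D"
proof -
  have "(f has_derivative (\<lambda>h. h \<bullet> D)) (at x)"
    using assms by (simp add: gderiv_def)
  then have "frechet_derivative f (at x) = (\<lambda>h. h \<bullet> D)"
    by (rule frechet_derivative_at[symmetric])
  then show ?thesis
    by (simp add: grad_def inner_commute[of _ D] euclidean_representation)
qed

text \<open>The classes of \<open>k\<close> times continuously differentiable functions on an \<^emph>\<open>open\<close> set.
  Only the values on the set matter.\<close>

primrec Ck_on :: "nat \<Rightarrow> 'a::euclidean_space set \<Rightarrow> ('a \<Rightarrow> real) \<Rightarrow> bool" where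
  "Ck_on 0 \<Omega> f \<longleftrightarrow> continuous_on \<Omega> f"
| "Ck_on (Suc k) \<Omega> f \<longleftrightarrow> f differentiable_on \<Omega> \<and> (\<forall>i\<in>Basis. Ck_on k \<Omega> (\<lambda>x. grad f x \<bullet> i))"

text \<open>Test functions are taken to be defined on the whole space (extended by zero).\<close>

definition test_function :: "'a::euclidean_space set \<Rightarrow> ('a \<Rightarrow> real) \<Rightarrow> bool" where
  "test_function \<Omega> \<phi> \<longleftrightarrow>
     (\<forall>k. Ck_on k UNIV \<phi>) \<and> compact (closure {x. \<phi> x \<noteq> 0}) \<and> closure {x. \<phi> x \<noteq> 0} \<subseteq> \<Omega>"

text \<open>Functions are used in place of their almost everywhere classes throughout.\<close>

definition Lp_on :: "'a::euclidean_space set \<Rightarrow> real \<Rightarrow> ('a \<Rightarrow> 'b::euclidean_space) \<Rightarrow> bool" where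
  "Lp_on \<Omega> p g \<longleftrightarrow>
     g \<in> borel_measurable (lebesgue_on \<Omega>) \<and> integrable (lebesgue_on \<Omega>) (\<lambda>x. norm (g x) powr p)"

definition Linf_norm :: "'a::euclidean_space set \<Rightarrow> ('a \<Rightarrow> real) \<Rightarrow> ereal" where
  "Linf_norm \<Omega> f = esssup (lebesgue_on \<Omega>) (\<lambda>x. ereal \<bar>f x\<bar>)"

definition Linf_on :: "'a::euclidean_space set \<Rightarrow> ('a \<Rightarrow> real) \<Rightarrow> bool" where
  "Linf_on \<Omega> f \<longleftrightarrow> f \<in> borel_measurable (lebesgue_on \<Omega>) \<and> Linf_norm \<Omega> f < \<infinity>"

definition locally_integrable_on ::
    "'a::euclidean_space set \<Rightarrow> ('a \<Rightarrow> 'b::euclidean_space) \<Rightarrow> bool" where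
  "locally_integrable_on \<Omega> g \<longleftrightarrow> (\<forall>K. compact K \<and> K \<subseteq> \<Omega> \<longrightarrow> g absolutely_integrable_on K)"

definition has_weak_gradient_on ::
    "'a::euclidean_space set \<Rightarrow> ('a \<Rightarrow> real) \<Rightarrow> ('a \<Rightarrow> 'a) \<Rightarrow> bool" where
  "has_weak_gradient_on \<Omega> u Du \<longleftrightarrow>
     locally_integrable_on \<Omega> u \<and> locally_integrable_on \<Omega> Du \<and>
     (\<forall>\<phi>. test_function \<Omega> \<phi> \<longrightarrow> (\<forall>i\<in>Basis.
        (LINT x|lebesgue_on \<Omega>. u x * (grad \<phi> x \<bullet> i)) =
        - (LINT x|lebesgue_on \<Omega>. (Du x \<bullet> i) * \<phi> x)))"

definition W1p_on :: "'a::euclidean_space set \<Rightarrow> real \<Rightarrow> ('a \<Rightarrow> real) \<Rightarrow> bool" where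
  "W1p_on \<Omega> p u \<longleftrightarrow> Lp_on \<Omega> p u \<and> (\<exists>Du. has_weak_gradient_on \<Omega> u Du \<and> Lp_on \<Omega> p Du)"

text \<open>In the two notions of weak solution below \<open>Du\<close> ranges over all representatives of the weak
  gradient. They agree almost everywhere on an open set, so the choice of one is immaterial, and
  at least one exists by membership in the Sobolev space.\<close>

definition p_laplace_weak_solution ::
    "'a::euclidean_space set \<Rightarrow> real \<Rightarrow> ('a \<Rightarrow> real) \<Rightarrow> ('a \<Rightarrow> real) \<Rightarrow> bool" where
  "p_laplace_weak_solution \<Omega> p f u \<longleftrightarrow>
     W1p_on \<Omega> p u \<and>
     (\<forall>Du. has_weak_gradient_on \<Omega> u Du \<longrightarrow> (\<forall>\<phi>. test_function \<Omega> \<phi> \<longrightarrow>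
        (LINT x|lebesgue_on \<Omega>. (norm (Du x) powr (p - 2) *\<^sub>R Du x) \<bullet> grad \<phi> x)
        + (LINT x|lebesgue_on \<Omega>. f x * \<phi> x) = 0))"

definition laplace_weak_solution :: "'a::euclidean_space set \<Rightarrow> ('a \<Rightarrow> real) \<Rightarrow> bool" where
  "laplace_weak_solution \<Omega> u \<longleftrightarrow>
     W1p_on \<Omega> 2 u \<and>
     (\<forall>Du. has_weak_gradient_on \<Omega> u Du \<longrightarrow> (\<forall>\<phi>. test_function \<Omega> \<phi> \<longrightarrow>
        (LINT x|lebesgue_on \<Omega>. Du x \<bullet> grad \<phi> x) = 0))"

text \<open>Convergence in the usual topology of \<open>C\<^sup>1(\<Omega>)\<close> for open \<open>\<Omega>\<close>: functions and gradients converge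
  uniformly on compact subsets. Convergence in the supremum norm over \<open>\<Omega>\<close> is a special case.\<close>

definition C1_converges_on ::
    "'a::euclidean_space set \<Rightarrow> (nat \<Rightarrow> 'a \<Rightarrow> real) \<Rightarrow> ('a \<Rightarrow> real) \<Rightarrow> bool" where
  "C1_converges_on \<Omega> u v \<longleftrightarrow>
     (\<forall>K. compact K \<and> K \<subseteq> \<Omega> \<longrightarrow>
        uniform_limit K u v sequentially \<and>
        uniform_limit K (\<lambda>n. grad (u n)) (grad v) sequentially)"

lemma C1_converges_onI_uniform:
  assumes "uniform_limit \<Omega> u v sequentially"
    and "uniform_limit \<Omega> (\<lambda>n. grad (u n)) (grad v) sequentially"
  shows "C1_converges_on \<Omega> u v"
  unfolding C1_converges_on_def
  by (auto intro: uniform_limit_on_subset[OF assms(1)] uniform_limit_on_subset[OF assms(2)])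

end

theory Submission
  imports Defs
begin

text \<open>Since \<open>u\<^sub>n\<close> is of class \<open>C\<^sup>1\<close>, its classical gradient is a weak gradient and may be used in the
  weak formulation. On the support of a test function the gradients converge uniformly and
  \<open>p\<^sub>n \<rightarrow> 2\<close>, so the fluxes \<open>|Du\<^sub>n|\<^bsup>p\<^sub>n-2\<^esup> Du\<^sub>n\<close> are bounded and converge pointwise to \<open>Du\<^sub>\<infinity>\<close>, while the
  source terms are \<open>O(1/n)\<close>. Uniqueness of the weak gradient is not needed to pass to another
  representative: for a test function \<open>\<phi>\<close> each \<open>\<partial>\<^sub>i\<phi>\<close> is again a test function, so every weak
  gradient satisfies \<open>\<integral> Du \<cdot> D\<phi> = - \<integral> u \<Delta>\<phi>\<close>.\<close>

section \<open>Classical gradients, test functions and integrals over their supports\<close>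

lemma Ck_on_1D:
  fixes f :: "'a::euclidean_space \<Rightarrow> real"
  assumes "Ck_on (Suc 0) \<Omega> f" "open \<Omega>"
  shows "\<And>x. x \<in> \<Omega> \<Longrightarrow> (f has_derivative (\<lambda>h. grad f x \<bullet> h)) (at x)"
    and "continuous_on \<Omega> (grad f)"
    and "continuous_on \<Omega> f"
proof -
  show D: "(f has_derivative (\<lambda>h. grad f x \<bullet> h)) (at x)" if "x \<in> \<Omega>" for x
  proof -
    have "f differentiable (at x within \<Omega>)"
      using assms(1) that by (simp add: differentiable_on_def)
    \<comment> \<open>Openness of \<Omega> turns the derivative relative to the set into a full one,
      and \<open>grad\<close> is built from the latter.\<close>
    then have "f differentiable (at x)"
      by (simp only: at_within_open[OF that assms(2)])
    then have F: "(f has_derivative frechet_derivative f (at x)) (at x)"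
      using frechet_derivative_works by blast
    then interpret bounded_linear "frechet_derivative f (at x)"
      by (rule has_derivative_bounded_linear)
    have "frechet_derivative f (at x) h = grad f x \<bullet> h" for h
    proof -
      have "frechet_derivative f (at x) h
          = frechet_derivative f (at x) (\<Sum>i\<in>Basis. (h \<bullet> i) *\<^sub>R i)"
        by (simp add: euclidean_representation)
      also have "\<dots> = (\<Sum>i\<in>Basis. (h \<bullet> i) * frechet_derivative f (at x) i)"
        by (simp add: sum scaleR)
      also have "\<dots> = grad f x \<bullet> h"
        by (subst inner_commute) (simp add: grad_def inner_sum_right mult.commute)
      finally show ?thesis .
    qed
    then have "frechet_derivative f (at x) = (\<lambda>h. grad f x \<bullet> h)"
      by (rule ext)
    with F show ?thesis
      by (simp only:)
  qed
  show "continuous_on \<Omega> (grad f)"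
    using assms(1) by (simp add: continuous_on_componentwise[of \<Omega> "grad f"])
  show "continuous_on \<Omega> f"
    by (rule has_derivative_continuous_on[OF has_derivative_at_withinI[OF D]])
qed

lemma grad_eq_zero:
  fixes \<phi> :: "'a::euclidean_space \<Rightarrow> real"
  assumes "x \<notin> closure {x. \<phi> x \<noteq> 0}"
  shows "grad \<phi> x = 0"
proof (rule grad_eqI)
  have "((\<lambda>x. 0) has_derivative (\<lambda>h. h \<bullet> 0)) (at x)"
    by simp
  then have "(\<phi> has_derivative (\<lambda>h. h \<bullet> 0)) (at x)"
    by (rule has_derivative_transform_within_open[where s = "- closure {x. \<phi> x \<noteq> 0}"])
       (use assms closure_subset[of "{x. \<phi> x \<noteq> 0}"] in auto)
  then show "GDERIV \<phi> x :> 0"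
    by (simp add: gderiv_def)
qed

lemma test_functionD:
  fixes \<phi> :: "'a::euclidean_space \<Rightarrow> real"
  assumes "test_function \<Omega> \<phi>"
  shows "\<And>x. (\<phi> has_derivative (\<lambda>h. grad \<phi> x \<bullet> h)) (at x)"
    and "continuous_on S (grad \<phi>)"
    and "continuous_on S \<phi>"
    and "compact (closure {x. \<phi> x \<noteq> 0})"
    and "closure {x. \<phi> x \<noteq> 0} \<subseteq> \<Omega>"
    and "\<And>x. x \<notin> closure {x. \<phi> x \<noteq> 0} \<Longrightarrow> \<phi> x = 0"
proof -
  have "Ck_on (Suc 0) UNIV \<phi>"
    using assms unfolding test_function_def by blast
  note C = Ck_on_1D[OF this open_UNIV]
  show "\<And>x. (\<phi> has_derivative (\<lambda>h. grad \<phi> x \<bullet> h)) (at x)"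
    by (rule C(1)[OF UNIV_I])
  show "continuous_on S (grad \<phi>)" "continuous_on S \<phi>"
    by (rule continuous_on_subset[OF C(2) subset_UNIV] continuous_on_subset[OF C(3) subset_UNIV])+
  show "compact (closure {x. \<phi> x \<noteq> 0})" "closure {x. \<phi> x \<noteq> 0} \<subseteq> \<Omega>"
    using assms unfolding test_function_def by blast+
  show "\<And>x. x \<notin> closure {x. \<phi> x \<noteq> 0} \<Longrightarrow> \<phi> x = 0"
    using closure_subset[of "{x. \<phi> x \<noteq> 0}"] by blast
qed

lemma test_function_mono: "test_function A \<phi> \<Longrightarrow> A \<subseteq> B \<Longrightarrow> test_function B \<phi>"
  unfolding test_function_def by blast

text \<open>Smoothness of order \<open>Suc k\<close> for \<phi> unfolds to order \<open>k\<close>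
  for its partial derivatives. The support can only shrink, because the gradient vanishes off the
  closed support of \<phi>.\<close>

lemma test_function_grad:
  fixes \<phi> :: "'a::euclidean_space \<Rightarrow> real"
  assumes "test_function \<Omega> \<phi>" "i \<in> Basis"
  shows "test_function \<Omega> (\<lambda>x. grad \<phi> x \<bullet> i)"
proof -
  have "Ck_on k UNIV (\<lambda>x. grad \<phi> x \<bullet> i)" for k
  proof -
    have "Ck_on (Suc k) UNIV \<phi>"
      using assms unfolding test_function_def by blast
    then show ?thesis using assms by simp
  qed
  moreover have sub: "closure {x. grad \<phi> x \<bullet> i \<noteq> 0} \<subseteq> closure {x. \<phi> x \<noteq> 0}"
  proof (rule closure_minimal)
    show "{x. grad \<phi> x \<bullet> i \<noteq> 0} \<subseteq> closure {x. \<phi> x \<noteq> 0}"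
      using grad_eq_zero[of _ \<phi>] by fastforce
  qed simp
  moreover have "compact (closure {x. grad \<phi> x \<bullet> i \<noteq> 0})"
    using test_functionD(4)[OF assms(1)] sub
    by (meson bounded_subset closed_closure compact_eq_bounded_closed)
  ultimately show ?thesis
    using test_functionD(5)[OF assms(1)] unfolding test_function_def by blast
qed

text \<open>Lets integrals over different domains be exchanged for one over the whole space, where
  translation is available. Continuity is asked on \<open>K\<close> only, so \<open>h\<close> may
  jump at the boundary of \<open>K\<close>; cutting off by the indicator of \<open>K\<close> or of
  \<Omega> does not change \<open>h\<close>.\<close>

lemma integral_supported:
  fixes h :: "'a::euclidean_space \<Rightarrow> 'b::euclidean_space"
  assumes K: "compact K" "K \<subseteq> \<Omega>" and \<Omega>: "\<Omega> \<in> sets lebesgue"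
    and h: "continuous_on K h" "\<And>x. x \<notin> K \<Longrightarrow> h x = 0"
  shows "integrable lborel h"
    and "integrable (lebesgue_on \<Omega>) h"
    and "integral\<^sup>L (lebesgue_on \<Omega>) h = integral\<^sup>L lborel h"
proof -
  have "(\<lambda>x. indicator K x *\<^sub>R h x) = h"
    using h(2) by (auto simp: indicator_def fun_eq_iff)
  with borel_integrable_compact[OF K(1) h(1)] show i: "integrable lborel h"
    by simp
  have e: "(\<lambda>x. indicator \<Omega> x *\<^sub>R h x) = h"
    using h(2) K(2) by (auto simp: indicator_def fun_eq_iff)
  have m: "h \<in> borel_measurable lborel"
    using i by auto
  show "integrable (lebesgue_on \<Omega>) h"
    using i m \<Omega> by (simp add: integrable_restrict_space e integrable_completion)
  show "integral\<^sup>L (lebesgue_on \<Omega>) h = integral\<^sup>L lborel h"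
    using m \<Omega> by (simp add: integral_restrict_space e integral_completion)
qed

section \<open>Integration by parts against test functions\<close>

text \<open>Translation invariance makes the integral of every difference quotient vanish. The
  quotients are uniformly bounded and have a common compact support, so this passes to the limit.\<close>

lemma integral_directional_derivative_eq_zero:
  fixes w :: "'a::euclidean_space \<Rightarrow> real"
  assumes D: "\<And>x. (w has_derivative w' x) (at x)"
    and K: "compact K" "\<And>x. x \<notin> K \<Longrightarrow> w x = 0"
    and M: "\<And>x. \<bar>w' x i\<bar> \<le> M"
    and i: "i \<in> Basis"
  shows "(LINT x|lborel. w' x i) = 0"
proof -
  define e :: "nat \<Rightarrow> real" where "e n = 1 / real (Suc n)" for n
  define q where "q n x = (w (x + e n *\<^sub>R i) - w x) / e n" for n x
  have e: "e n > 0" "e n \<le> 1" for n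
    by (simp_all add: e_def)
  have e0: "e \<longlonglongrightarrow> 0"
    unfolding e_def using LIMSEQ_inverse_real_of_nat by (simp add: inverse_eq_divide)
  have cw: "continuous_on UNIV w"
    by (rule has_derivative_continuous_on[OF D])
  have [measurable]: "w \<in> borel_measurable borel"
    using cw by (rule borel_measurable_continuous_onI)
  have mq [measurable]: "q n \<in> borel_measurable borel" for n
    unfolding q_def by measurable
  have line: "((\<lambda>t. w (x + t *\<^sub>R i)) has_real_derivative w' (x + t *\<^sub>R i) i) (at t)" for x t
  proof -
    have "((\<lambda>t. x + t *\<^sub>R i) has_derivative (\<lambda>h. h *\<^sub>R i)) (at t)"
      by (auto intro!: derivative_eq_intros)
    from has_derivative_compose[OF this D]
    have "((\<lambda>t. w (x + t *\<^sub>R i)) has_derivative (\<lambda>h. w' (x + t *\<^sub>R i) (h *\<^sub>R i))) (at t)" .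
    moreover have "linear (w' (x + t *\<^sub>R i))"
      using D has_derivative_linear by blast
    ultimately show ?thesis
      by (simp add: has_field_derivative_def linear_cmul mult_commute_abs)
  qed
  have lim: "(\<lambda>n. q n x) \<longlonglongrightarrow> w' x i" for x
  proof -
    have "((\<lambda>h. (w (x + h *\<^sub>R i) - w x) / h) \<longlongrightarrow> w' x i) (at 0)"
      using DERIV_D[OF line[of x 0]] by simp
    moreover have "filterlim e (at 0) sequentially"
      using e0 e(1) by (auto simp: filterlim_at less_imp_neq[symmetric] intro: eventuallyI)
    ultimately show ?thesis
      unfolding q_def by (rule filterlim_compose)
  qed
  \<comment> \<open>By the mean value theorem a quotient is a value of the directional derivative at
    an intermediate point, so it inherits the bound \<open>M\<close>.\<close>
  have bound: "\<bar>q n x\<bar> \<le> M" for n x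
  proof -
    obtain z where "w (x + e n *\<^sub>R i) - w (x + 0 *\<^sub>R i) = (e n - 0) * w' (x + z *\<^sub>R i) i"
      using MVT2[OF e(1)[of n], of "\<lambda>t. w (x + t *\<^sub>R i)" "\<lambda>t. w' (x + t *\<^sub>R i) i"] line by blast
    then have "q n x = w' (x + z *\<^sub>R i) i"
      using e(1)[of n] by (simp add: q_def field_simps)
    then show ?thesis using M by simp
  qed
  obtain B where B: "\<And>x. x \<in> K \<Longrightarrow> norm x \<le> B"
    using compact_imp_bounded[OF K(1)] unfolding bounded_iff by blast
  \<comment> \<open>The step \<open>e n\<close> is at most 1, so enlarging the radius
    \<open>B\<close> by 1 captures the supports of all quotients at once.\<close>
  have supp: "q n x = 0" if "x \<notin> cball 0 (B + 1)" for n x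
  proof -
    have "x \<notin> K" "x + e n *\<^sub>R i \<notin> K"
    proof -
      show "x \<notin> K" using B[of x] that by auto
      have "norm x \<le> norm (x + e n *\<^sub>R i) + norm (e n *\<^sub>R i)"
        by (metis add_diff_cancel_right' norm_triangle_ineq4)
      also have "norm (e n *\<^sub>R i) \<le> 1"
        using e[of n] i by simp
      finally show "x + e n *\<^sub>R i \<notin> K" using B[of "x + e n *\<^sub>R i"] that by auto
    qed
    then show ?thesis by (simp add: q_def K(2))
  qed
  have iw: "integrable lborel w"
    using K continuous_on_subset[OF cw]
    by (intro integral_supported(1)[OF K(1) order_refl]) (simp_all add: borel_compact)
  have iq: "(LINT x|lborel. q n x) = 0" for n
  proof -
    have t: "integrable lborel (\<lambda>x. w (e n *\<^sub>R i + x))"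
      "(LINT x|lborel. w (e n *\<^sub>R i + x)) = (LINT x|lborel. w x)"
    proof -
      have "integrable (distr lborel borel ((+) (e n *\<^sub>R i))) w"
        using iw by (simp add: lborel_distr_plus)
      then show "integrable lborel (\<lambda>x. w (e n *\<^sub>R i + x))"
        by (subst (asm) integrable_distr_eq) auto
      have "(LINT x|distr lborel borel ((+) (e n *\<^sub>R i)). w x)
          = (LINT x|lborel. w (e n *\<^sub>R i + x))"
        by (rule integral_distr) auto
      then show "(LINT x|lborel. w (e n *\<^sub>R i + x)) = (LINT x|lborel. w x)"
        by (simp add: lborel_distr_plus)
    qed
    then show ?thesis
      using iw by (simp add: q_def add.commute)
  qed
  have "(\<lambda>n. LINT x|lborel. q n x) \<longlonglongrightarrow> (LINT x|lborel. w' x i)"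
  proof (rule integral_dominated_convergence[where w = "\<lambda>x. indicator (cball 0 (B + 1)) x *\<^sub>R M"])
    show "integrable lborel (\<lambda>x. indicator (cball 0 (B + 1)) x *\<^sub>R M)"
      by (rule borel_integrable_compact) auto
    \<comment> \<open>The derivative is measurable as the pointwise limit of the measurable
      quotients.\<close>
    show "(\<lambda>x. w' x i) \<in> borel_measurable lborel"
      by (rule borel_measurable_LIMSEQ_real[where u = q]) (use lim mq in auto)
    show "AE x in lborel. norm (q n x) \<le> indicator (cball 0 (B + 1)) x *\<^sub>R M" for n
    proof (rule AE_I2)
      fix x
      show "norm (q n x) \<le> indicator (cball 0 (B + 1)) x *\<^sub>R M"
        using bound[of n x] supp[of x n] by (cases "x \<in> cball 0 (B + 1)") auto
    qed
  qed (use lim in auto)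
  then show ?thesis
    by (simp add: iq LIMSEQ_const_iff)
qed

lemma locally_integrable_on_continuous:
  assumes "continuous_on \<Omega> g"
  shows "locally_integrable_on \<Omega> g"
  unfolding locally_integrable_on_def
proof safe
  fix K assume K: "compact K" "K \<subseteq> \<Omega>"
  then have *: "integrable lborel (\<lambda>x. indicator K x *\<^sub>R g x)"
    using assms borel_integrable_compact continuous_on_subset by blast
  then have "(\<lambda>x. indicator K x *\<^sub>R g x) \<in> borel_measurable lborel"
    by auto
  with * show "g absolutely_integrable_on K"
    unfolding set_integrable_def by (simp add: integrable_completion)
qed

text \<open>The product of \<open>u\<close> and \<phi> is differentiable on the whole space and has
  compact support, so its partial derivatives integrate to zero; the product rule splits this into
  the two sides of the identity.\<close>

lemma has_weak_gradient_on_grad: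
  fixes u :: "'a::euclidean_space \<Rightarrow> real"
  assumes \<Omega>: "open \<Omega>" and u: "Ck_on (Suc 0) \<Omega> u"
  shows "has_weak_gradient_on \<Omega> u (grad u)"
  unfolding has_weak_gradient_on_def
proof (intro conjI allI impI ballI)
  note u = Ck_on_1D[OF u \<Omega>]
  show "locally_integrable_on \<Omega> u" "locally_integrable_on \<Omega> (grad u)"
    using u by (auto intro: locally_integrable_on_continuous)
  fix \<phi> :: "'a \<Rightarrow> real" and i :: 'a
  assume \<phi>: "test_function \<Omega> \<phi>" and i: "i \<in> Basis"
  define K where "K = closure {x. \<phi> x \<noteq> 0}"
  note T = test_functionD[OF \<phi>, folded K_def]
  have z: "grad \<phi> x = 0" "\<phi> x = 0" if "x \<notin> K" for x
    using that grad_eq_zero[of x \<phi>] T(6)[of x] unfolding K_def by blast+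
  have \<Omega>s: "\<Omega> \<in> sets lebesgue"
    using \<Omega> by auto
  have cu: "continuous_on K u" "continuous_on K (grad u)"
    using u T(5) by (auto intro: continuous_on_subset)
  have c: "continuous_on K (\<lambda>x. u x * (grad \<phi> x \<bullet> i))" "continuous_on K (\<lambda>x. (grad u x \<bullet> i) * \<phi> x)"
    by (intro continuous_on_mult continuous_on_inner continuous_on_const cu T(2,3))+
  note I1 = integral_supported[OF T(4,5) \<Omega>s c(1)]
  note I2 = integral_supported[OF T(4,5) \<Omega>s c(2)]
  define w' where "w' x h = u x * (grad \<phi> x \<bullet> h) + (grad u x \<bullet> h) * \<phi> x" for x h
  have D: "((\<lambda>x. u x * \<phi> x) has_derivative w' x) (at x)" for x
  proof (cases "x \<in> K")
    case True
    then have "x \<in> \<Omega>"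
      using T(5) by blast
    from has_derivative_mult[OF u(1)[OF this] T(1)[of x]] show ?thesis
      by (simp add: w'_def[abs_def])
  next
    \<comment> \<open>Here \<open>u\<close> may fail to be differentiable, but the product vanishes
      on the open complement of \<open>K\<close>.\<close>
    case False
    have "((\<lambda>x. 0::real) has_derivative (\<lambda>h. 0)) (at x)"
      by simp
    then have "((\<lambda>x. u x * \<phi> x) has_derivative (\<lambda>h. 0)) (at x)"
      by (rule has_derivative_transform_within_open[where s = "- K"])
         (use False z(2) T(4) in \<open>auto simp: compact_imp_closed\<close>)
    then show ?thesis
      using False z by (simp add: w'_def[abs_def])
  qed
  have "bounded ((\<lambda>x. w' x i) ` K)"
    unfolding w'_def using c by (intro compact_imp_bounded compact_continuous_image continuous_on_add T(4))
  then obtain M where M: "\<And>x. x \<in> K \<Longrightarrow> \<bar>w' x i\<bar> \<le> M"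
    by (auto simp: bounded_iff)
  \<comment> \<open>The maximum covers the value 0 off \<open>K\<close>: \<open>M\<close> could be
    negative if \<open>K\<close> is empty.\<close>
  have M': "\<bar>w' x i\<bar> \<le> max M 0" for x
    using M[of x] z[of x] by (cases "x \<in> K") (auto simp: w'_def)
  have "(LINT x|lborel. w' x i) = 0"
    by (rule integral_directional_derivative_eq_zero[OF D T(4) _ M' i]) (simp add: z)
  then show "(LINT x|lebesgue_on \<Omega>. u x * (grad \<phi> x \<bullet> i)) =
        - (LINT x|lebesgue_on \<Omega>. (grad u x \<bullet> i) * \<phi> x)"
    using I1 I2 z by (simp add: w'_def)
qed

text \<open>The right-hand side does not mention \<open>Du\<close>, so all weak gradients of
  \<open>u\<close> give the same integral. It arises by testing the i-th weak derivative with the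
  i-th partial derivative of \<phi>.\<close>

lemma has_weak_gradient_on_integral_grad:
  fixes u :: "'a::euclidean_space \<Rightarrow> real"
  assumes \<Omega>: "open \<Omega>" and Du: "has_weak_gradient_on \<Omega> u Du" and \<phi>: "test_function \<Omega> \<phi>"
  shows "(LINT x|lebesgue_on \<Omega>. Du x \<bullet> grad \<phi> x) =
    - (\<Sum>i\<in>Basis. LINT x|lebesgue_on \<Omega>. u x * (grad (\<lambda>y. grad \<phi> y \<bullet> i) x \<bullet> i))"
proof -
  define K where "K = closure {x. \<phi> x \<noteq> 0}"
  note T = test_functionD[OF \<phi>, folded K_def]
  have z: "grad \<phi> x = 0" if "x \<notin> K" for x
    using that grad_eq_zero by (auto simp: K_def)
  \<comment> \<open>Integrability of each summand is what allows the integral to be split.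
    \<open>Du\<close> is integrable on the compact support \<open>K\<close>, and the gradient of
    \<phi> is bounded there and zero elsewhere.\<close>
  have I: "integrable (lebesgue_on \<Omega>) (\<lambda>x. (Du x \<bullet> i) * (grad \<phi> x \<bullet> i))" if i: "i \<in> Basis" for i
  proof -
    have "Du absolutely_integrable_on K"
      using Du T(4,5) unfolding has_weak_gradient_on_def locally_integrable_on_def by blast
    then have iD: "integrable lebesgue (\<lambda>x. indicator K x *\<^sub>R Du x)"
      by (simp add: set_integrable_def)
    have "bounded (grad \<phi> ` K)"
      using T(2,4) by (intro compact_imp_bounded compact_continuous_image)
    then obtain M where M: "\<And>x. x \<in> K \<Longrightarrow> norm (grad \<phi> x) \<le> M"
      by (auto simp: bounded_iff)
    have "integrable lebesgue (\<lambda>x. ((indicator K x *\<^sub>R Du x) \<bullet> i) * (grad \<phi> x \<bullet> i))"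
    proof (rule Bochner_Integration.integrable_bound)
      show "integrable lebesgue (\<lambda>x. M * norm (indicator K x *\<^sub>R Du x))"
        using iD by (intro integrable_mult_right integrable_norm)
      have "grad \<phi> \<in> borel_measurable borel"
        using T(2) by (rule borel_measurable_continuous_onI)
      then have "grad \<phi> \<in> borel_measurable lebesgue"
        by (intro measurable_completion) simp
      with iD show "(\<lambda>x. ((indicator K x *\<^sub>R Du x) \<bullet> i) * (grad \<phi> x \<bullet> i)) \<in> borel_measurable lebesgue"
        by (intro borel_measurable_times borel_measurable_inner borel_measurable_const)
            (rule borel_measurable_integrable)
      show "AE x in lebesgue. norm (((indicator K x *\<^sub>R Du x) \<bullet> i) * (grad \<phi> x \<bullet> i))
          \<le> norm (M * norm (indicator K x *\<^sub>R Du x))"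
      proof (rule AE_I2)
        fix x
        show "norm (((indicator K x *\<^sub>R Du x) \<bullet> i) * (grad \<phi> x \<bullet> i))
          \<le> norm (M * norm (indicator K x *\<^sub>R Du x))"
        proof (cases "x \<in> K")
          case True
          have "\<bar>Du x \<bullet> i\<bar> * \<bar>grad \<phi> x \<bullet> i\<bar> \<le> norm (Du x) * M"
            using Basis_le_norm[OF i, of "Du x"] Basis_le_norm[OF i, of "grad \<phi> x"] M[OF True]
            by (intro mult_mono) auto
          also have "\<dots> \<le> \<bar>M\<bar> * norm (Du x)"
            by (simp add: mult.commute mult_right_mono)
          finally show ?thesis using True by (simp add: abs_mult)
        qed simp
      qed
    qed
    moreover have "((indicator K x *\<^sub>R Du x) \<bullet> i) * (grad \<phi> x \<bullet> i)
        = indicator \<Omega> x *\<^sub>R ((Du x \<bullet> i) * (grad \<phi> x \<bullet> i))" for x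
      using T(5) z[of x] by (auto simp: indicator_def)
    ultimately have "integrable lebesgue (\<lambda>x. indicator \<Omega> x *\<^sub>R ((Du x \<bullet> i) * (grad \<phi> x \<bullet> i)))"
      by (simp only:)
    then show ?thesis
      using \<Omega> by (simp add: integrable_restrict_space)
  qed
  have "(LINT x|lebesgue_on \<Omega>. Du x \<bullet> grad \<phi> x)
      = (LINT x|lebesgue_on \<Omega>. (\<Sum>i\<in>Basis. (Du x \<bullet> i) * (grad \<phi> x \<bullet> i)))"
    by (subst euclidean_inner) simp
  also have "\<dots> = (\<Sum>i\<in>Basis. LINT x|lebesgue_on \<Omega>. (Du x \<bullet> i) * (grad \<phi> x \<bullet> i))"
    using I by (rule Bochner_Integration.integral_sum)
  also have "\<dots> = (\<Sum>i\<in>Basis. - (LINT x|lebesgue_on \<Omega>. u x * (grad (\<lambda>y. grad \<phi> y \<bullet> i) x \<bullet> i)))"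
  proof (rule sum.cong[OF refl])
    fix i :: 'a assume i: "i \<in> Basis"
    then show "(LINT x|lebesgue_on \<Omega>. (Du x \<bullet> i) * (grad \<phi> x \<bullet> i)) =
      - (LINT x|lebesgue_on \<Omega>. u x * (grad (\<lambda>y. grad \<phi> y \<bullet> i) x \<bullet> i))"
      using Du test_function_grad[OF \<phi> i] unfolding has_weak_gradient_on_def by force
  qed
  finally show ?thesis by (simp add: sum_negf)
qed

section \<open>Membership in Lebesgue spaces and the sign of the essential supremum\<close>

lemma Lp_on_continuous_on_compact:
  fixes g :: "'a::euclidean_space \<Rightarrow> 'b::euclidean_space"
  assumes K: "compact K" "continuous_on K g" and \<Omega>: "\<Omega> \<subseteq> K" "\<Omega> \<in> sets lebesgue" and p: "p > 0"
  shows "Lp_on \<Omega> p g"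
proof -
  have "(\<lambda>x. norm (g x) powr p) absolutely_integrable_on K"
  proof -
    \<comment> \<open>Positivity of \<open>p\<close> gives continuity at the zeros of
      \<open>g\<close>.\<close>
    have "continuous_on K (\<lambda>x. norm (g x) powr p)"
      using K p by (intro continuous_on_powr' continuous_on_norm continuous_on_const) auto
    then show ?thesis
      using locally_integrable_on_continuous K(1) unfolding locally_integrable_on_def by blast
  qed
  then have "(\<lambda>x. norm (g x) powr p) absolutely_integrable_on \<Omega>"
    by (rule set_integrable_subset[OF _ \<Omega>(2,1)])
  then have "integrable (lebesgue_on \<Omega>) (\<lambda>x. norm (g x) powr p)"
    using \<Omega> by (simp add: integrable_restrict_space set_integrable_def)
  then show ?thesis
    using continuous_imp_measurable_on_sets_lebesgue[OF continuous_on_subset[OF K(2) \<Omega>(1)] \<Omega>(2)]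
    by (simp add: Lp_on_def)
qed

text \<open>On a space of measure zero the essential supremum is minus infinity. A nonempty open set
  has positive measure, so the constant 0 has essential supremum 0 and monotonicity applies.\<close>

lemma Linf_norm_nonneg:
  assumes \<Omega>: "open \<Omega>" "\<Omega> \<noteq> {}" and f: "f \<in> borel_measurable (lebesgue_on \<Omega>)"
  shows "0 \<le> Linf_norm \<Omega> f"
proof -
  have "\<not> negligible \<Omega>"
    using \<Omega> open_not_negligible by blast
  then have "emeasure (lebesgue_on \<Omega>) (space (lebesgue_on \<Omega>)) \<noteq> 0"
    using \<Omega> by (simp add: emeasure_restrict_space negligible_iff_null_sets null_sets_def)
  then have "0 = esssup (lebesgue_on \<Omega>) (\<lambda>x. 0)"
    by (simp add: esssup_const)
  also have "\<dots> \<le> Linf_norm \<Omega> f"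
    unfolding Linf_norm_def by (rule esssup_mono) auto
  finally show ?thesis .
qed

section \<open>Convergence of the fluxes as the exponents tend to 2\<close>

text \<open>Where \<open>v = 0\<close> the power \<open>norm (v n) powr a n\<close> need not converge, but it stays bounded
  by \<open>1\<close> eventually.\<close>

lemma tendsto_norm_powr_scaleR:
  fixes v :: "nat \<Rightarrow> 'a::real_normed_vector"
  assumes v: "v \<longlonglongrightarrow> l" and a: "a \<longlonglongrightarrow> 0" "\<And>n. a n \<ge> 0"
  shows "(\<lambda>n. norm (v n) powr a n *\<^sub>R v n) \<longlonglongrightarrow> l"
proof (cases "l = 0")
  case False
  have "(\<lambda>n. norm (v n) powr a n *\<^sub>R v n) \<longlonglongrightarrow> norm l powr 0 *\<^sub>R l"
    using False by (intro tendsto_intros v a) auto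
  then show ?thesis using False by simp
next
  case True
  have "(\<lambda>n. norm (v n)) \<longlonglongrightarrow> 0"
    using v True by (simp add: tendsto_norm_zero)
  moreover from this have "eventually (\<lambda>n. norm (v n) < 1) sequentially"
    by (rule order_tendstoD) simp
  then have "eventually (\<lambda>n. norm (norm (v n) powr a n *\<^sub>R v n) \<le> norm (v n)) sequentially"
  proof eventually_elim
    case (elim n)
    then have "norm (v n) powr a n \<le> 1"
      using a(2)[of n] by (intro powr_le1) auto
    then have "norm (v n) powr a n * norm (v n) \<le> 1 * norm (v n)"
      by (intro mult_right_mono) auto
    then show ?case by simp
  qed
  ultimately show ?thesis
    unfolding True by (metis Lim_null_comparison)
qed

text \<open>Dominated convergence: pointwise convergence comes from
  \<open>tendsto_norm_powr_scaleR\<close>, and uniform convergence on \<open>K\<close> supplies a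
  constant bound for all large \<open>n\<close>.\<close>

lemma tendsto_integral_norm_powr_inner:
  fixes v :: "nat \<Rightarrow> 'a::euclidean_space \<Rightarrow> 'a"
  assumes K: "compact K" and lim: "uniform_limit K v l sequentially"
    and v: "\<And>n. continuous_on K (v n)"
    and a: "a \<longlonglongrightarrow> 0" "\<And>n. 0 < a n" "\<And>n. a n \<le> 1"
    and g: "continuous_on K g" "\<And>x. x \<notin> K \<Longrightarrow> g x = 0"
  shows "(\<lambda>n. LINT x|lborel. (norm (v n x) powr a n *\<^sub>R v n x) \<bullet> g x)
    \<longlonglongrightarrow> (LINT x|lborel. l x \<bullet> g x)"
proof -
  have cl: "continuous_on K l"
    using uniform_limit_theorem[OF _ lim] v by simp
  have Ks: "K \<in> sets lebesgue"
    using K by (simp add: borel_compact)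
  obtain L G where L: "\<And>x. x \<in> K \<Longrightarrow> norm (l x) \<le> L" and G: "\<And>x. x \<in> K \<Longrightarrow> norm (g x) \<le> G"
    using compact_imp_bounded[OF compact_continuous_image[OF cl K]]
      compact_imp_bounded[OF compact_continuous_image[OF g(1) K]]
    by (auto simp: bounded_iff)
  \<comment> \<open>The factors bound the power, the vector \<open>v n x\<close> and
    \<open>g x\<close> in turn, once \<open>v n\<close> is within 1 of \<open>l\<close>. Absolute
    values keep them nonnegative even for empty \<open>K\<close>.\<close>
  define C where "C = (\<bar>L\<bar> + 1) * (\<bar>L\<bar> + 1) * \<bar>G\<bar>"
  obtain N where N: "\<And>n x. n \<ge> N \<Longrightarrow> x \<in> K \<Longrightarrow> dist (v n x) (l x) < 1"
    using uniform_limitD[OF lim, of 1] by (auto simp: eventually_sequentially)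
  \<comment> \<open>Strict positivity of \<open>a n\<close> matters at zeros of \<open>v n\<close>:
    since \<open>0 powr 0 = 0\<close>, exponent 0 would make the power jump there.\<close>
  have ci: "continuous_on K (\<lambda>x. (norm (v n x) powr a n *\<^sub>R v n x) \<bullet> g x)" for n
    using v a(2)[of n] g(1) by (intro continuous_on_inner continuous_on_scaleR continuous_on_powr' continuous_on_norm continuous_on_const) auto
  \<comment> \<open>Starting at \<open>N\<close> makes the domination hold for every index;
    \<open>LIMSEQ_offset\<close> removes the shift at the end.\<close>
  have "(\<lambda>n. LINT x|lborel. (norm (v (n + N) x) powr a (n + N) *\<^sub>R v (n + N) x) \<bullet> g x)
    \<longlonglongrightarrow> (LINT x|lborel. l x \<bullet> g x)"
  proof (rule integral_dominated_convergence[where w = "\<lambda>x. indicator K x *\<^sub>R C"])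
    show "integrable lborel (\<lambda>x. indicator K x *\<^sub>R C)"
      using K by (intro borel_integrable_compact) auto
    show "(\<lambda>x. l x \<bullet> g x) \<in> borel_measurable lborel"
      using g cl by (intro borel_measurable_integrable integral_supported(1)[OF K order_refl Ks])
        (auto intro: continuous_on_inner)
    show "(\<lambda>x. (norm (v (n + N) x) powr a (n + N) *\<^sub>R v (n + N) x) \<bullet> g x) \<in> borel_measurable lborel"
      for n
      using g ci by (intro borel_measurable_integrable integral_supported(1)[OF K order_refl Ks]) auto
    show "AE x in lborel. (\<lambda>n. (norm (v (n + N) x) powr a (n + N) *\<^sub>R v (n + N) x) \<bullet> g x)
        \<longlonglongrightarrow> l x \<bullet> g x"
    proof (rule AE_I2)
      fix x
      show "(\<lambda>n. (norm (v (n + N) x) powr a (n + N) *\<^sub>R v (n + N) x) \<bullet> g x) \<longlonglongrightarrow> l x \<bullet> g x"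
      proof (cases "x \<in> K")
        case True
        have "(\<lambda>n. norm (v n x) powr a n *\<^sub>R v n x) \<longlonglongrightarrow> l x"
          using a(2) by (intro tendsto_norm_powr_scaleR a tendsto_uniform_limitI[OF lim True])
            (simp add: less_imp_le)
        from LIMSEQ_ignore_initial_segment[OF this, of N] show ?thesis
          by (intro tendsto_intros)
      qed (simp add: g)
    qed
    show "AE x in lborel. norm ((norm (v (n + N) x) powr a (n + N) *\<^sub>R v (n + N) x) \<bullet> g x)
        \<le> indicator K x *\<^sub>R C" for n
    proof (rule AE_I2)
      fix x
      let ?v = "v (n + N) x" and ?a = "a (n + N)"
      show "norm ((norm ?v powr ?a *\<^sub>R ?v) \<bullet> g x) \<le> indicator K x *\<^sub>R C"
      proof (cases "x \<in> K")
        case True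
        have "norm ?v \<le> norm (l x) + dist ?v (l x)"
          by (metis dist_norm norm_triangle_sub)
        then have 1: "norm ?v \<le> \<bar>L\<bar> + 1"
          using N[of "n + N" x] L[of x] True by simp
        have "norm ?v powr ?a \<le> (\<bar>L\<bar> + 1) powr ?a"
          using 1 a(2)[of "n + N"] by (intro powr_mono2) auto
        \<comment> \<open>The base is at least 1, so raising the exponent to 1 only increases the
          power.\<close>
        also have "\<dots> \<le> (\<bar>L\<bar> + 1) powr 1"
          using a(3) by (intro powr_mono) auto
        finally have 2: "norm ?v powr ?a \<le> \<bar>L\<bar> + 1" by simp
        have "norm ((norm ?v powr ?a *\<^sub>R ?v) \<bullet> g x) \<le> norm ?v powr ?a * norm ?v * norm (g x)"
          using Cauchy_Schwarz_ineq2[of "norm ?v powr ?a *\<^sub>R ?v" "g x"] by simp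
        also have "\<dots> \<le> C"
          unfolding C_def using 1 2 G[OF True] by (intro mult_mono) auto
        finally show ?thesis using True by simp
      qed (simp add: g)
    qed
  qed
  then show ?thesis by (rule LIMSEQ_offset)
qed

section \<open>Passage to the limit in the weak formulation\<close>

theorem proposition1:
  fixes p :: "nat \<Rightarrow> real"
    and f u :: "nat \<Rightarrow> 'a::euclidean_space \<Rightarrow> real"
    and u_inf :: "'a \<Rightarrow> real"
  assumes "\<And>n. n \<ge> 1 \<Longrightarrow> p n > 2"
    and "\<And>n. n \<ge> 1 \<Longrightarrow> Linf_on (ball 0 1) (f n)"
    and "\<And>n. n \<ge> 1 \<Longrightarrow> ereal \<bar>p n - 2\<bar> + Linf_norm (ball 0 1) (f n) \<le> ereal (1 / real n)"
    and "\<And>n. n \<ge> 1 \<Longrightarrow> p_laplace_weak_solution (ball 0 1) (p n) (f n) (u n)"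
    and "\<And>n. n \<ge> 1 \<Longrightarrow> Ck_on 1 (ball 0 1) (u n)"
    and "Ck_on 1 (ball 0 1) u_inf"
    and "C1_converges_on (ball 0 1) u u_inf"
  shows "laplace_weak_solution (ball 0 (9/10)) u_inf"
proof -
  let ?B = "ball (0::'a) 1" and ?b = "ball (0::'a) (9/10)"
  have bB: "cball (0::'a) (9/10) \<subseteq> ?B" "?b \<subseteq> ?B" "?b \<subseteq> cball (0::'a) (9/10)"
    by auto
  have ui: "Ck_on (Suc 0) ?B u_inf"
    using assms(6) by simp
  note U = Ck_on_1D[OF ui open_ball]
  have ui': "Ck_on (Suc 0) ?b u_inf"
    using ui bB(2) by (auto intro: continuous_on_subset differentiable_on_subset)
  have wg: "has_weak_gradient_on ?b u_inf (grad u_inf)"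
    using has_weak_gradient_on_grad[OF open_ball ui'] .
  have pn: "0 < p n - 2" "p n - 2 \<le> 1 / real n"
    and fn: "AE x in lebesgue_on ?B. \<bar>f n x\<bar> \<le> 1 / real n" if n: "n \<ge> 1" for n
  proof -
    show "0 < p n - 2" using assms(1)[OF n] by simp
    \<comment> \<open>Both summands in the smallness assumption are nonnegative, so each of them
      alone is at most \<open>1 / real n\<close>.\<close>
    have "0 \<le> Linf_norm ?B (f n)"
      using assms(2)[OF n] by (intro Linf_norm_nonneg) (auto simp: Linf_on_def)
    then have "ereal \<bar>p n - 2\<bar> + 0 \<le> ereal \<bar>p n - 2\<bar> + Linf_norm ?B (f n)"
      by (rule add_left_mono)
    also note assms(3)[OF n]
    finally show "p n - 2 \<le> 1 / real n" by simp
    have "0 + Linf_norm ?B (f n) \<le> ereal \<bar>p n - 2\<bar> + Linf_norm ?B (f n)"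
      by (rule add_right_mono) simp
    also note assms(3)[OF n]
    finally have le: "Linf_norm ?B (f n) \<le> ereal (1 / real n)" by simp
    have "AE x in lebesgue_on ?B. ereal \<bar>f n x\<bar> \<le> Linf_norm ?B (f n)"
      unfolding Linf_norm_def by (rule esssup_AE)
    then show "AE x in lebesgue_on ?B. \<bar>f n x\<bar> \<le> 1 / real n"
    proof eventually_elim
      case (elim x)
      with le show ?case using order_trans ereal_less_eq(3) by blast
    qed
  qed
  have main: "(LINT x|lebesgue_on ?b. grad u_inf x \<bullet> grad \<phi> x) = 0" if \<phi>: "test_function ?b \<phi>" for \<phi>
  proof -
    define K where "K = closure {x. \<phi> x \<noteq> 0}"
    have \<phi>B: "test_function ?B \<phi>"
      using test_function_mono[OF \<phi> bB(2)] .
    note T = test_functionD[OF \<phi>, folded K_def]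
    have KB: "K \<subseteq> ?B"
      using T(5) bB by blast
    have z: "grad \<phi> x = 0" "\<phi> x = 0" if "x \<notin> K" for x
      using that grad_eq_zero[of x \<phi>] T(6)[of x] unfolding K_def by blast+
    have s: "?B \<in> sets lebesgue" "?b \<in> sets lebesgue"
      by auto
    \<comment> \<open>The hypotheses concern indices from 1 on, hence the shift by one.\<close>
    let ?u = "\<lambda>n. u (Suc n)"
    let ?I = "\<lambda>n. LINT x|lborel. (norm (grad (?u n) x) powr (p (Suc n) - 2) *\<^sub>R grad (?u n) x) \<bullet> grad \<phi> x"
    have un: "Ck_on (Suc 0) ?B (?u n)" for n
      using assms(5)[of "Suc n"] by simp
    have cu: "continuous_on K (grad (?u n))" for n
      using Ck_on_1D(2)[OF un open_ball] KB continuous_on_subset by blast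
    have "uniform_limit K (\<lambda>n. grad (u n)) (grad u_inf) sequentially"
      using assms(7) T(4) KB unfolding C1_converges_on_def by blast
    then have ul: "uniform_limit K (\<lambda>n. grad (?u n)) (grad u_inf) sequentially"
      by (rule filterlim_compose) (rule filterlim_Suc)
    have a1: "0 < p (Suc n) - 2" for n
      by (rule pn(1)) simp
    have le: "p (Suc n) - 2 \<le> 1 / real (Suc n)" for n
      by (rule pn(2)) simp
    have i0: "(\<lambda>n. 1 / real (Suc n)) \<longlonglongrightarrow> 0"
      using LIMSEQ_inverse_real_of_nat by (simp only: inverse_eq_divide)
    have a0: "(\<lambda>n. p (Suc n) - 2) \<longlonglongrightarrow> 0"
      by (rule real_tendsto_sandwich[OF _ _ tendsto_const i0])
         (rule always_eventually allI less_imp_le a1 le)+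
    have a2: "p (Suc n) - 2 \<le> 1" for n
      using le[of n] by (rule order_trans) simp
    have lim: "?I \<longlonglongrightarrow> (LINT x|lborel. grad u_inf x \<bullet> grad \<phi> x)"
      by (rule tendsto_integral_norm_powr_inner[OF T(4) ul cu a0 a1 a2 T(2) z(1)])
    \<comment> \<open>The equation tested with \<phi>, using the classical gradient as weak
      gradient, turns the flux integral into minus the source integral, which is at most the L1 norm
      of \<phi> times the sup bound on the source.\<close>
    have bd: "\<bar>?I n\<bar> \<le> (LINT x|lebesgue_on ?B. \<bar>\<phi> x\<bar>) * (1 / real (Suc n))" for n
    proof -
      have "has_weak_gradient_on ?B (?u n) (grad (?u n))"
        by (rule has_weak_gradient_on_grad[OF open_ball un])
      then have eq: "(LINT x|lebesgue_on ?B.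
          (norm (grad (?u n) x) powr (p (Suc n) - 2) *\<^sub>R grad (?u n) x) \<bullet> grad \<phi> x)
          + (LINT x|lebesgue_on ?B. f (Suc n) x * \<phi> x) = 0"
        using assms(4)[of "Suc n", simplified] \<phi>B unfolding p_laplace_weak_solution_def by blast
      have c: "continuous_on K (\<lambda>x. (norm (grad (?u n) x) powr (p (Suc n) - 2) *\<^sub>R grad (?u n) x) \<bullet> grad \<phi> x)"
        by (intro continuous_on_inner continuous_on_scaleR continuous_on_powr' continuous_on_norm
              continuous_on_const cu T(2)) (use a1[of n] in auto)
      have "?I n = - (LINT x|lebesgue_on ?B. f (Suc n) x * \<phi> x)"
        using eq integral_supported(3)[OF T(4) KB s(1) c] by (simp add: z(1))
      moreover have "integrable (lebesgue_on ?B) (\<lambda>x. \<bar>\<phi> x\<bar>)"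
        by (rule integral_supported(2)[OF T(4) KB s(1) continuous_on_rabs[OF T(3)]]) (simp add: z(2))
      then have "norm (LINT x|lebesgue_on ?B. f (Suc n) x * \<phi> x)
          \<le> (LINT x|lebesgue_on ?B. \<bar>\<phi> x\<bar> * (1 / real (Suc n)))"
      proof (intro integral_norm_bound[THEN order_trans] integral_mono_AE')
        show "AE x in lebesgue_on ?B. norm (f (Suc n) x * \<phi> x) \<le> \<bar>\<phi> x\<bar> * (1 / real (Suc n))"
          using fn[OF Suc_leI[OF zero_less_Suc, folded One_nat_def], of n]
        proof eventually_elim
          case (elim x)
          from mult_left_mono[OF this abs_ge_zero[of "\<phi> x"]] show ?case
            by (simp only: abs_mult real_norm_def mult.commute)
        qed
      qed simp_all
      ultimately show ?thesis by simp
    qed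
    have b0: "(\<lambda>n. (LINT x|lebesgue_on ?B. \<bar>\<phi> x\<bar>) * (1 / real (Suc n))) \<longlonglongrightarrow> 0"
      by (rule tendsto_mult_right_zero[OF i0])
    have "?I \<longlonglongrightarrow> 0"
      by (rule Lim_null_comparison[OF _ b0], unfold real_norm_def, intro always_eventually allI, rule bd)
    from LIMSEQ_unique[OF lim this] have "(LINT x|lborel. grad u_inf x \<bullet> grad \<phi> x) = 0" .
    \<comment> \<open>The support \<open>K\<close> lies in both balls, so the integral over the
      smaller ball is again the one over the whole space.\<close>
    moreover have "(LINT x|lebesgue_on ?b. grad u_inf x \<bullet> grad \<phi> x) = (LINT x|lborel. grad u_inf x \<bullet> grad \<phi> x)"
      by (rule integral_supported(3)[OF T(4,5) s(2)
              continuous_on_inner[OF continuous_on_subset[OF U(2) KB] T(2)]]) (simp add: z(1))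
    ultimately show ?thesis by simp
  qed
  have "W1p_on ?b 2 u_inf"
    unfolding W1p_on_def
  proof (intro conjI exI)
    \<comment> \<open>The closed ball of radius 9/10 is compact in the unit ball, so
      \<open>u_inf\<close> and its gradient are bounded on it, although either may blow up towards
      the unit sphere.\<close>
    show "Lp_on ?b 2 u_inf" "Lp_on ?b 2 (grad u_inf)"
      by (rule Lp_on_continuous_on_compact[OF compact_cball continuous_on_subset[OF U(3) bB(1)] bB(3)]
            Lp_on_continuous_on_compact[OF compact_cball continuous_on_subset[OF U(2) bB(1)] bB(3)];
          simp)+
  qed (rule wg)
  \<comment> \<open>Both \<open>Du\<close> and the classical gradient yield the same expression in
    \<open>u_inf\<close>, and for the latter the integral is zero by \<open>main\<close>.\<close>
  moreover have "(LINT x|lebesgue_on ?b. Du x \<bullet> grad \<phi> x) = 0"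
    if "has_weak_gradient_on ?b u_inf Du" "test_function ?b \<phi>" for Du \<phi>
    using has_weak_gradient_on_integral_grad[OF open_ball that]
      has_weak_gradient_on_integral_grad[OF open_ball wg that(2)] main[OF that(2)] by simp
  ultimately show ?thesis
    unfolding laplace_weak_solution_def by simp
qed

end
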